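(* Let $G$ be the simply connected 4-dimensional Lie group whose Lie algebra has a basis $X_1,X_2,X_3,X_4$ with $$[X_1,X_4]=[X_2,X_4]=[X_3,X_4]=0,\quad [X_2,X_3]=-X_4,\quad [X_3,X_1]=X_2,\quad [X_1,X_2]=X_3 .$$ For real numbers $a_1,\dots,a_6$ let $$Y_1=X_1+a_4X_2+a_5X_3+a_6X_4,\quad Y_2=X_2+a_2X_3+a_3X_4,\quad Y_3=X_3+a_1X_4,\quad Y_4=X_4 .$$ Suppose the left-invariant metric $g_0$ on $G$ is diagonal in the basis $Y_i$, i.e. $g_0(Y_i,Y_j)=\lambda_i\delta_{ij}$ with $\lambda_i>0$. Then the Ricci flow solution $g(t)$ with $g(0)=g_0$ remains diagonal in the basis $Y_i$ if and only if $a_2=0$, $a_1=a_5$ and $a_3=a_4$.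
   Context: Elements of the Lie algebra are identified with left-invariant vector fields on $G$. The Ricci flow solution $g(t)$ is the left-invariant solution of $\frac{\partial}{\partial t}g(t)=-2\operatorname{Ric}(g(t))$, $g(0)=g_0$ (equivalently, the solution of the corresponding ODE on inner products on the Lie algebra). "$g(t)$ remains diagonal in the basis $Y_i$" means $g(t)(Y_i,Y_j)=0$ for all $i\ne j$ and all $t\ge0$ in its maximal interval of existence. *)

theory Defs
  imports "HOL-Analysis.Analysis"
begin

text \<open>
  A left-invariant metric on a connected Lie group is the same thing as an inner product on its
  Lie algebra, and its Levi-Civita connection, curvature and Ricci tensor are determined by their
  values on left-invariant vector fields, that is, on elements of the Lie algebra. Here a Lie
  algebra is a bracket on \<open>real ^ 'n\<close>, and an inner product on it is an arbitrary
  positive definite form \<open>g\<close>, unrelated to the standard one.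
\<close>

definition lie_bracket :: "(real ^ 'n \<Rightarrow> real ^ 'n \<Rightarrow> real ^ 'n) \<Rightarrow> bool" where
  "lie_bracket br \<longleftrightarrow>
     bilinear br \<and> (\<forall>u. br u u = 0) \<and>
     (\<forall>u v w. br u (br v w) + br v (br w u) + br w (br u v) = 0)"

definition inner_product :: "(real ^ 'n \<Rightarrow> real ^ 'n \<Rightarrow> real) \<Rightarrow> bool" where
  "inner_product g \<longleftrightarrow>
     bilinear g \<and> (\<forall>u v. g u v = g v u) \<and> (\<forall>u. u \<noteq> 0 \<longrightarrow> g u u > 0)"

text \<open>
  On left-invariant fields the functions \<open>g v w\<close> are constant, so metric compatibility
  \<open>u (g v w) = g (D u v) w + g v (D u w)\<close> has left-hand side zero.
\<close>

definition levi_civita_connection ::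
  "(real ^ 'n \<Rightarrow> real ^ 'n \<Rightarrow> real ^ 'n) \<Rightarrow> (real ^ 'n \<Rightarrow> real ^ 'n \<Rightarrow> real) \<Rightarrow>
   (real ^ 'n \<Rightarrow> real ^ 'n \<Rightarrow> real ^ 'n) \<Rightarrow> bool" where
  "levi_civita_connection br g D \<longleftrightarrow>
     bilinear D \<and>
     (\<forall>u v. D u v - D v u = br u v) \<and>
     (\<forall>u v w. g (D u v) w + g v (D u w) = 0)"

definition levi_civita ::
  "(real ^ 'n \<Rightarrow> real ^ 'n \<Rightarrow> real ^ 'n) \<Rightarrow> (real ^ 'n \<Rightarrow> real ^ 'n \<Rightarrow> real) \<Rightarrow>
   real ^ 'n \<Rightarrow> real ^ 'n \<Rightarrow> real ^ 'n" where
  "levi_civita br g = (THE D. levi_civita_connection br g D)"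

definition curvature ::
  "(real ^ 'n \<Rightarrow> real ^ 'n \<Rightarrow> real ^ 'n) \<Rightarrow> (real ^ 'n \<Rightarrow> real ^ 'n \<Rightarrow> real) \<Rightarrow>
   real ^ 'n \<Rightarrow> real ^ 'n \<Rightarrow> real ^ 'n \<Rightarrow> real ^ 'n" where
  "curvature br g u v w =
     (let D = levi_civita br g in D u (D v w) - D v (D u w) - D (br u v) w)"

definition ricci ::
  "(real ^ 'n \<Rightarrow> real ^ 'n \<Rightarrow> real ^ 'n) \<Rightarrow> (real ^ 'n \<Rightarrow> real ^ 'n \<Rightarrow> real) \<Rightarrow>
   real ^ 'n \<Rightarrow> real ^ 'n \<Rightarrow> real" where
  "ricci br g v w = trace (matrix (\<lambda>u. curvature br g u v w))"

definition ricci_flow ::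
  "(real ^ 'n \<Rightarrow> real ^ 'n \<Rightarrow> real ^ 'n) \<Rightarrow> (real ^ 'n \<Rightarrow> real ^ 'n \<Rightarrow> real) \<Rightarrow>
   real set \<Rightarrow> (real \<Rightarrow> real ^ 'n \<Rightarrow> real ^ 'n \<Rightarrow> real) \<Rightarrow> bool" where
  "ricci_flow br g0 I g \<longleftrightarrow>
     open I \<and> is_interval I \<and> 0 \<in> I \<and> g 0 = g0 \<and>
     (\<forall>t\<in>I. inner_product (g t)) \<and>
     (\<forall>t\<in>I. \<forall>u v. ((\<lambda>s. g s u v) has_real_derivative - 2 * ricci br (g t) u v) (at t))"

text \<open>Values of \<open>g\<close> outside \<open>I\<close> are irrelevant.\<close>

definition maximal_ricci_flow ::
  "(real ^ 'n \<Rightarrow> real ^ 'n \<Rightarrow> real ^ 'n) \<Rightarrow> (real ^ 'n \<Rightarrow> real ^ 'n \<Rightarrow> real) \<Rightarrow>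
   real set \<Rightarrow> (real \<Rightarrow> real ^ 'n \<Rightarrow> real ^ 'n \<Rightarrow> real) \<Rightarrow> bool" where
  "maximal_ricci_flow br g0 I g \<longleftrightarrow>
     ricci_flow br g0 I g \<and>
     (\<forall>J h. ricci_flow br g0 J h \<and> I \<subseteq> J \<and> (\<forall>t\<in>I. h t = g t) \<longrightarrow> J = I)"

text \<open>The description in the definition of \<open>levi_civita\<close> is proper.\<close>

lemma inner_product_riesz:
  fixes g :: "real ^ 'n \<Rightarrow> real ^ 'n \<Rightarrow> real"
  assumes g: "inner_product g" and f: "linear f"
  shows "\<exists>!w. \<forall>z. g w z = f z"
proof -
  have bg: "bilinear g" and pos: "\<And>u. u \<noteq> 0 \<Longrightarrow> g u u > 0"
    using g by (auto simp: inner_product_def)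
  define L where "L w = (\<chi> i. g w (axis i 1))" for w
  have lin1: "linear (g w)" for w using bg by (simp add: bilinear_def)
  have eqI: "h1 = h2"
    if "linear h1" "linear h2" "\<And>i. h1 (axis i 1) = h2 (axis i 1)"
    for h1 h2 :: "real ^ 'n \<Rightarrow> real"
    by (rule linear_eq_stdbasis[OF that(1,2)]) (use that(3) in \<open>auto simp: Basis_vec_def\<close>)
  have "linear L"
    by (rule linearI)
       (simp_all add: L_def vec_eq_iff bilinear_ladd[OF bg] bilinear_lmul[OF bg])
  moreover have inj: "w = w'" if "\<And>z. g w z = g w' z" for w w'
  proof (rule ccontr)
    assume "w \<noteq> w'"
    then have "g (w - w') (w - w') > 0" using pos by simp
    moreover have "g (w - w') (w - w') = 0"
      using that by (simp add: bilinear_lsub[OF bg])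
    ultimately show False by simp
  qed
  moreover have "inj L"
  proof (rule injI)
    fix w w' assume "L w = L w'"
    then have "g w = g w'" by (intro eqI lin1) (simp add: L_def vec_eq_iff)
    then show "w = w'" by (intro inj) simp
  qed
  ultimately have "surj L" by (simp add: linear_injective_imp_surjective)
  then obtain w where w: "L w = (\<chi> i. f (axis i 1))" by (metis surjD)
  then have "g w = f" by (intro eqI lin1 f) (simp add: L_def vec_eq_iff)
  then show ?thesis using inj by auto
qed

lemma levi_civita_connection_koszul:
  fixes g :: "real ^ 'n \<Rightarrow> real ^ 'n \<Rightarrow> real"
  assumes g: "inner_product g" and D: "levi_civita_connection br g D"
  shows "g (D u v) w = (g (br u v) w - g (br v w) u + g (br w u) v) / 2"
proof -
  have bg: "bilinear g" and sym: "\<And>u v. g u v = g v u"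
    using g by (auto simp: inner_product_def)
  have br: "br x y = D x y - D y x" for x y
    using D by (simp add: levi_civita_connection_def)
  have "g (D x y) z + g y (D x z) = 0" for x y z
    using D by (simp add: levi_civita_connection_def)
  then have met: "g (D x y) z = - g (D x z) y" for x y z
    by (metis eq_neg_iff_add_eq_0 sym)
  show ?thesis
    unfolding br bilinear_lsub[OF bg]
    using met[of u v w] met[of v u w] met[of w u v] by simp
qed

lemma ex1_levi_civita_connection:
  fixes g :: "real ^ 'n \<Rightarrow> real ^ 'n \<Rightarrow> real"
  assumes g: "inner_product g" and lie: "lie_bracket br"
  shows "\<exists>!D. levi_civita_connection br g D"
proof -
  have bg: "bilinear g" and sym: "\<And>u v. g u v = g v u"
    using g by (auto simp: inner_product_def)
  have bb: "bilinear br" and alt: "\<And>u. br u u = 0"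
    using lie by (auto simp: lie_bracket_def)
  note gs = bilinear_ladd[OF bg] bilinear_radd[OF bg] bilinear_lmul[OF bg] bilinear_rmul[OF bg]
    bilinear_lsub[OF bg] bilinear_rsub[OF bg] bilinear_lneg[OF bg]
  note bs = bilinear_ladd[OF bb] bilinear_radd[OF bb] bilinear_lmul[OF bb] bilinear_rmul[OF bb]
  have "br (u + v) (u + v) = br u v + br v u" for u v
    using alt[of u] alt[of v] by (simp add: bs)
  then have skew: "br u v = - br v u" for u v
    by (metis alt eq_neg_iff_add_eq_0)
  define K where "K u v w = (g (br u v) w - g (br v w) u + g (br w u) v) / 2" for u v w
  have "linear (K u v)" for u v
    by (rule linearI) (simp_all add: K_def gs bs algebra_simps add_divide_distrib diff_divide_distrib)
  then have "\<forall>u v. \<exists>w. \<forall>z. g w z = K u v z"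
    using inner_product_riesz[OF g] by blast
  then obtain D where D: "\<And>u v z. g (D u v) z = K u v z" by metis
  have eqI: "w = w'" if "\<And>z. g w z = g w' z" for w w'
  proof -
    have "linear (g w')" using bg by (simp add: bilinear_def)
    from inner_product_riesz[OF g this] that show ?thesis by auto
  qed
  have "bilinear D"
    unfolding bilinear_def
    by (intro conjI allI linearI; rule eqI)
       (simp_all add: gs D K_def bs algebra_simps add_divide_distrib diff_divide_distrib)
  moreover have "D u v - D v u = br u v" for u v
  proof (rule eqI)
    fix z
    show "g (D u v - D v u) z = g (br u v) z"
      using skew[of v u] skew[of u z] skew[of v z] by (simp add: gs D K_def field_simps)
  qed
  moreover have "g (D u v) w + g v (D u w) = 0" for u v w
    using skew[of v u] skew[of w u] skew[of w v] sym[of v "D u w"]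
    by (simp add: gs D K_def field_simps)
  ultimately have "levi_civita_connection br g D" by (simp add: levi_civita_connection_def)
  moreover have "D1 = D2"
    if "levi_civita_connection br g D1" "levi_civita_connection br g D2" for D1 D2
    using levi_civita_connection_koszul[OF g that(1)] levi_civita_connection_koszul[OF g that(2)]
    by (intro ext eqI) (simp only:)
  ultimately show ?thesis by blast
qed

end

theory Submission
  imports Defs
begin

text \<open>
  The frame \<open>Y\<close> satisfies \<open>[Y2, Y3] = - Y4\<close>, \<open>[Y3, Y1] = Y2 - b Y3 + p Y4\<close> and
  \<open>[Y1, Y2] = - b Y2 + (1 + b\<^sup>2) Y3 + q Y4\<close>, where \<open>b = a 2\<close> and where \<open>b = p = q = 0\<close> is the condition of
  the theorem. If the flow stays diagonal, differentiating at \<open>t = 0\<close> shows that the Ricci tensor of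
  \<open>g0\<close> is diagonal; its entries (2,4) and (3,4) form an invertible linear system for \<open>p\<close> and \<open>q\<close>, and
  then the entry (2,3) is a nonzero multiple of \<open>b\<close>. Conversely, if \<open>b = p = q = 0\<close>, every diagonal metric
  has diagonal Ricci tensor. As the Ricci tensor is locally Lipschitz in the metric, the off-diagonal
  entries of \<open>g t\<close> then satisfy a linear differential inequality and vanish by Gronwall.
\<close>

section \<open>Frames, coordinate functionals and traces\<close>

text \<open>The index set is arbitrary, so that both the frame \<open>Y\<close> over
  \<open>{1..4}\<close> and the standard basis over \<open>UNIV\<close> are instances. The last
  clause makes the \<open>y i\<close> the coordinate functionals of \<open>Y\<close>.\<close>

definition dual_frame :: "'i set \<Rightarrow> ('i \<Rightarrow> real ^ 'n) \<Rightarrow> ('i \<Rightarrow> real ^ 'n \<Rightarrow> real) \<Rightarrow> bool" where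
  "dual_frame S Y y \<longleftrightarrow>
     finite S \<and> (\<forall>i\<in>S. linear (y i)) \<and>
     (\<forall>i\<in>S. \<forall>j\<in>S. y i (Y j) = (if i = j then 1 else 0)) \<and>
     (\<forall>u. (\<Sum>i\<in>S. y i u *\<^sub>R Y i) = u)"

text \<open>Off-diagonal frame entries of \<open>g\<close> are discarded. This is the comparison
  metric for measuring how far a flow has left the diagonal metrics.\<close>

definition diagonal_part ::
  "'i set \<Rightarrow> ('i \<Rightarrow> real ^ 'n) \<Rightarrow> ('i \<Rightarrow> real ^ 'n \<Rightarrow> real) \<Rightarrow>
   (real ^ 'n \<Rightarrow> real ^ 'n \<Rightarrow> real) \<Rightarrow> real ^ 'n \<Rightarrow> real ^ 'n \<Rightarrow> real" where
  "diagonal_part S Y y g u v = (\<Sum>i\<in>S. g (Y i) (Y i) * y i u * y i v)"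

text \<open>Expanding \<open>axis k 1\<close> in the frame and exchanging the sums reassembles
  \<open>f (Y i)\<close> from its standard coordinates. This moves \<open>ricci\<close>, defined
  through the standard basis, into a frame adapted to the metric.\<close>

lemma trace_dual_frame:
  fixes f :: "real ^ 'n \<Rightarrow> real ^ 'n"
  assumes frame: "dual_frame S Y y" and f: "linear f"
  shows "trace (matrix f) = (\<Sum>i\<in>S. y i (f (Y i)))"
proof -
  have y: "linear (y i)" if "i \<in> S" for i
    using frame that by (simp add: dual_frame_def)
  have "f (axis k 1) = (\<Sum>i\<in>S. y i (axis k 1) *\<^sub>R f (Y i))" for k
  proof -
    have "axis k 1 = (\<Sum>i\<in>S. y i (axis k 1) *\<^sub>R Y i)"
      using frame by (simp add: dual_frame_def)
    then have "f (axis k 1) = f (\<Sum>i\<in>S. y i (axis k 1) *\<^sub>R Y i)" by simp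
    then show ?thesis by (simp add: linear_sum[OF f] linear_cmul[OF f])
  qed
  then have "trace (matrix f) = (\<Sum>k\<in>UNIV. \<Sum>i\<in>S. y i (axis k 1) * f (Y i) $ k)"
    by (simp add: trace_def matrix_def)
  also have "\<dots> = (\<Sum>i\<in>S. \<Sum>k\<in>UNIV. y i (axis k 1) * f (Y i) $ k)"
    by (rule sum.swap)
  also have "\<dots> = (\<Sum>i\<in>S. y i (f (Y i)))"
  proof (rule sum.cong[OF refl])
    fix i assume i: "i \<in> S"
    have "f (Y i) = (\<Sum>k\<in>UNIV. (f (Y i) $ k) *\<^sub>R axis k 1)"
      using basis_expansion[of "f (Y i)"] by (simp add: scalar_mult_eq_scaleR)
    then have "y i (f (Y i)) = y i (\<Sum>k\<in>UNIV. (f (Y i) $ k) *\<^sub>R axis k 1)"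
      by simp
    also have "\<dots> = (\<Sum>k\<in>UNIV. y i (axis k 1) * f (Y i) $ k)"
      by (simp add: linear_sum[OF y[OF i]] linear_cmul[OF y[OF i]] mult.commute)
    finally show "(\<Sum>k\<in>UNIV. y i (axis k 1) * f (Y i) $ k) = y i (f (Y i))" ..
  qed
  finally show ?thesis .
qed

lemma levi_civita_connection_levi_civita:
  assumes "inner_product g" and "lie_bracket br"
  shows "levi_civita_connection br g (levi_civita br g)"
  unfolding levi_civita_def by (rule theI'[OF ex1_levi_civita_connection[OF assms]])

lemma linear_curvature:
  assumes "inner_product g" and "lie_bracket br"
  shows "linear (\<lambda>u. curvature br g u v w)"
proof -
  have D: "bilinear (levi_civita br g)"
    using levi_civita_connection_levi_civita[OF assms] by (simp add: levi_civita_connection_def)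
  have b: "bilinear br" using assms by (simp add: lie_bracket_def)
  note s = bilinear_ladd[OF D] bilinear_radd[OF D] bilinear_lmul[OF D] bilinear_rmul[OF D]
    bilinear_ladd[OF b] bilinear_lmul[OF b]
  show ?thesis
    by (rule linearI) (simp_all add: curvature_def Let_def s algebra_simps)
qed

lemma bilinear_expand_frame:
  fixes f :: "real ^ 'n \<Rightarrow> real ^ 'n \<Rightarrow> 'b::real_vector"
  assumes frame: "dual_frame S Y y" and f: "bilinear f"
  shows "f u v = (\<Sum>i\<in>S. \<Sum>j\<in>S. (y i u * y j v) *\<^sub>R f (Y i) (Y j))"
proof -
  have l: "linear (\<lambda>x. f x z)" and r: "linear (f z)" for z
    using f by (auto simp: bilinear_def)
  have "f u v = f (\<Sum>i\<in>S. y i u *\<^sub>R Y i) (\<Sum>j\<in>S. y j v *\<^sub>R Y j)"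
    using frame by (simp add: dual_frame_def)
  also have "\<dots> = (\<Sum>i\<in>S. y i u *\<^sub>R f (Y i) (\<Sum>j\<in>S. y j v *\<^sub>R Y j))"
    by (simp only: linear_sum[OF l] bilinear_lmul[OF f])
  also have "\<dots> = (\<Sum>i\<in>S. \<Sum>j\<in>S. (y i u * y j v) *\<^sub>R f (Y i) (Y j))"
    by (simp add: linear_sum[OF r] bilinear_rmul[OF f] scaleR_sum_right)
  finally show ?thesis .
qed

text \<open>In the coordinates \<open>y i\<close> the quadratic form is a sum of squares with
  positive weights, and a nonzero vector has a nonzero coordinate.\<close>

lemma inner_product_diagonal_part:
  assumes frame: "dual_frame S Y y" and g: "inner_product g"
  shows "inner_product (diagonal_part S Y y g)"
proof -
  have y: "linear (y i)" if "i \<in> S" for i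
    using frame that by (simp add: dual_frame_def)
  have fin: "finite S" using frame by (simp add: dual_frame_def)
  have nz: "Y i \<noteq> 0" if "i \<in> S" for i
    using frame that y[OF that] linear_0[OF y[OF that]] unfolding dual_frame_def by fastforce
  then have pos: "g (Y i) (Y i) > 0" if "i \<in> S" for i
    using g that by (simp add: inner_product_def)
  have "bilinear (diagonal_part S Y y g)"
    unfolding bilinear_def diagonal_part_def
    by (auto intro!: linearI sum.cong
        simp: linear_add[OF y] linear_cmul[OF y] sum.distrib[symmetric] sum_distrib_left algebra_simps)
  moreover have "diagonal_part S Y y g u v = diagonal_part S Y y g v u" for u v
    by (simp add: diagonal_part_def mult_ac)
  moreover have "diagonal_part S Y y g u u > 0" if u: "u \<noteq> 0" for u
  proof -
    have "\<exists>i\<in>S. y i u \<noteq> 0"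
    proof (rule ccontr)
      assume "\<not> ?thesis"
      then have "(\<Sum>i\<in>S. y i u *\<^sub>R Y i) = 0" by simp
      then show False using frame u by (simp add: dual_frame_def)
    qed
    then obtain i where i: "i \<in> S" "y i u \<noteq> 0" by blast
    show ?thesis
      unfolding diagonal_part_def
    proof (rule sum_pos2[OF fin i(1)])
      show "0 < g (Y i) (Y i) * y i u * y i u"
        using pos[OF i(1)] i(2) by (simp add: mult.assoc not_sum_power2_lt_zero zero_less_mult_iff) argo
      show "0 \<le> g (Y j) (Y j) * y j u * y j u" if "j \<in> S" for j
        using pos[OF that] by (simp add: mult.assoc)
    qed
  qed
  ultimately show ?thesis by (simp add: inner_product_def)
qed

lemma diagonal_part_frame:
  assumes frame: "dual_frame S Y y" and "i \<in> S" "j \<in> S"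
  shows "diagonal_part S Y y g (Y i) (Y j) = (if i = j then g (Y i) (Y i) else 0)"
proof -
  have fin: "finite S" using frame by (simp add: dual_frame_def)
  have "diagonal_part S Y y g (Y i) (Y j) =
      (\<Sum>k\<in>S. if k = i then (if k = j then g (Y k) (Y k) else 0) else 0)"
    unfolding diagonal_part_def
    using assms by (intro sum.cong) (auto simp: dual_frame_def)
  then show ?thesis using fin assms by simp
qed

section \<open>The Ricci tensor in an orthogonal frame\<close>

text \<open>
  \<open>c i j k\<close> is the \<open>Y k\<close>-coefficient of the bracket of \<open>Y i\<close> and \<open>Y j\<close>, and \<open>l i\<close> is the squared
  length of \<open>Y i\<close> in a metric for which the frame \<open>Y\<close> is orthogonal.
\<close>

definition frame_connection :: "('i \<Rightarrow> 'i \<Rightarrow> 'i \<Rightarrow> real) \<Rightarrow> ('i \<Rightarrow> real) \<Rightarrow> 'i \<Rightarrow> 'i \<Rightarrow> 'i \<Rightarrow> real" where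
  "frame_connection c l i j k = (c i j k * l k - c j k i * l i + c k i j * l j) / (2 * l k)"

text \<open>With \<open>frame_connection\<close> as Christoffel symbols, the inner sum is the
  \<open>Y k\<close>-coefficient of R(Y k, Y i) Y j, so the outer sum is the trace that defines
  \<open>ricci\<close>.\<close>

definition frame_ricci :: "'i set \<Rightarrow> ('i \<Rightarrow> 'i \<Rightarrow> 'i \<Rightarrow> real) \<Rightarrow> ('i \<Rightarrow> real) \<Rightarrow> 'i \<Rightarrow> 'i \<Rightarrow> real" where
  "frame_ricci S c l i j =
     (\<Sum>k\<in>S. \<Sum>m\<in>S.
        frame_connection c l i j m * frame_connection c l k m k
        - frame_connection c l k j m * frame_connection c l i m k
        - c k i m * frame_connection c l m j k)"

text \<open>By orthogonality, pairing with \<open>Y k\<close> multiplies the \<open>k\<close>-th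
  coordinate by the squared length of \<open>Y k\<close>. Hence the Koszul formula gives each
  connection coefficient separately.\<close>

lemma ricci_orthogonal_frame:
  assumes frame: "dual_frame S Y y" and g: "inner_product g" and lie: "lie_bracket br"
    and orth: "\<And>i j. i \<in> S \<Longrightarrow> j \<in> S \<Longrightarrow> i \<noteq> j \<Longrightarrow> g (Y i) (Y j) = 0"
    and ij: "i \<in> S" "j \<in> S"
  shows "ricci br g (Y i) (Y j) =
    frame_ricci S (\<lambda>i j k. y k (br (Y i) (Y j))) (\<lambda>i. g (Y i) (Y i)) i j"
proof -
  let ?D = "levi_civita br g" and ?c = "\<lambda>i j k. y k (br (Y i) (Y j))"
    and ?l = "\<lambda>i. g (Y i) (Y i)"
  let ?G = "frame_connection ?c ?l"
  have fin: "finite S" and y: "\<And>i. i \<in> S \<Longrightarrow> linear (y i)"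
    and rep: "\<And>u. (\<Sum>i\<in>S. y i u *\<^sub>R Y i) = u"
    using frame by (auto simp: dual_frame_def)
  have bg: "bilinear g" using g by (simp add: inner_product_def)
  note conn = levi_civita_connection_levi_civita[OF g lie]
  have bD: "bilinear ?D" using conn by (simp add: levi_civita_connection_def)
  have bb: "bilinear br" using lie by (simp add: lie_bracket_def)
  have nz: "?l i \<noteq> 0" if "i \<in> S" for i
  proof -
    have "Y i \<noteq> 0" using frame that linear_0[OF y[OF that]] unfolding dual_frame_def by fastforce
    then show ?thesis using g by (metis inner_product_def less_irrefl)
  qed
  have gY: "g u (Y k) = y k u * ?l k" if k: "k \<in> S" for u k
  proof -
    have l: "linear (\<lambda>x. g x (Y k))" using bg by (simp add: bilinear_def)
    have "g u (Y k) = g (\<Sum>i\<in>S. y i u *\<^sub>R Y i) (Y k)" by (simp add: rep)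
    also have "\<dots> = (\<Sum>i\<in>S. if i = k then y k u * ?l k else 0)"
      unfolding linear_sum[OF l] using k
      by (intro sum.cong) (auto simp: bilinear_lmul[OF bg] orth)
    finally show ?thesis using fin k by simp
  qed
  have G: "y k (?D (Y i) (Y j)) = ?G i j k" if "i \<in> S" "j \<in> S" "k \<in> S" for i j k
    using levi_civita_connection_koszul[OF g conn, of "Y i" "Y j" "Y k"] nz[OF that(3)]
    unfolding gY[OF that(3), of "?D (Y i) (Y j)"] gY[OF that(3), of "br (Y i) (Y j)"]
      gY[OF that(1), of "br (Y j) (Y k)"] gY[OF that(2), of "br (Y k) (Y i)"]
    by (simp add: frame_connection_def field_simps)
  \<comment> \<open>The curvature needs \<open>?D (Y a)\<close> on vectors outside the frame;
    linearity reduces this to the coefficients \<open>?G\<close>. \<open>DL\<close> does the same in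
    the differentiating slot, for the bracket term.\<close>
  have DD: "y k (?D (Y a) u) = (\<Sum>m\<in>S. y m u * ?G a m k)" if "a \<in> S" "k \<in> S" for a k u
  proof -
    have r: "linear (?D (Y a))" using bD by (simp add: bilinear_def)
    have "y k (?D (Y a) u) = y k (?D (Y a) (\<Sum>m\<in>S. y m u *\<^sub>R Y m))" by (simp add: rep)
    also have "\<dots> = (\<Sum>m\<in>S. y m u * ?G a m k)"
      by (simp add: linear_sum[OF r] linear_sum[OF y[OF that(2)]] bilinear_rmul[OF bD]
          linear_cmul[OF y[OF that(2)]] G that)
    finally show ?thesis .
  qed
  have DL: "y k (?D u (Y a)) = (\<Sum>m\<in>S. y m u * ?G m a k)" if "a \<in> S" "k \<in> S" for a k u
  proof -
    have r: "linear (\<lambda>x. ?D x (Y a))" using bD by (simp add: bilinear_def)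
    have "y k (?D u (Y a)) = y k (?D (\<Sum>m\<in>S. y m u *\<^sub>R Y m) (Y a))" by (simp add: rep)
    also have "\<dots> = (\<Sum>m\<in>S. y m u * ?G m a k)"
      by (simp add: linear_sum[OF r] linear_sum[OF y[OF that(2)]] bilinear_lmul[OF bD]
          linear_cmul[OF y[OF that(2)]] G that)
    finally show ?thesis .
  qed
  have "ricci br g (Y i) (Y j) = (\<Sum>k\<in>S. y k (curvature br g (Y k) (Y i) (Y j)))"
    unfolding ricci_def by (rule trace_dual_frame[OF frame linear_curvature[OF g lie]])
  also have "\<dots> = frame_ricci S ?c ?l i j"
    unfolding frame_ricci_def
  proof (rule sum.cong[OF refl])
    fix k assume k: "k \<in> S"
    show "y k (curvature br g (Y k) (Y i) (Y j)) =
        (\<Sum>m\<in>S. ?G i j m * ?G k m k - ?G k j m * ?G i m k - ?c k i m * ?G m j k)"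
      using k ij
      by (simp add: curvature_def Let_def linear_diff[OF y[OF k]] DD[of k k "?D (Y i) (Y j)"]
          DD[of i k "?D (Y k) (Y j)"] DL[of j k "br (Y k) (Y i)"] G sum_subtractf)
  qed
  finally show ?thesis .
qed

section \<open>Lipschitz dependence of the Ricci tensor on the metric\<close>

text \<open>The Koszul expression is linear in the metric, and the lower bound \<open>m\<close>
  turns an estimate of \<open>g z z\<close> into one of \<open>norm z\<close>. This bounds each
  connection, and the difference of two connections by a multiple of \<open>e\<close>. The curvature
  is quadratic in the connection up to a linear bracket term.\<close>

lemma ricci_lipschitz:
  fixes br :: "real ^ 'n \<Rightarrow> real ^ 'n \<Rightarrow> real ^ 'n"
  assumes lie: "lie_bracket br" and m: "m > 0" and M: "M \<ge> 0"
  shows "\<exists>L\<ge>0. \<forall>g h e v w. inner_product g \<longrightarrow> inner_product h \<longrightarrow>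
    (\<forall>u. m * (norm u)\<^sup>2 \<le> g u u) \<longrightarrow> (\<forall>u. m * (norm u)\<^sup>2 \<le> h u u) \<longrightarrow>
    (\<forall>u v. \<bar>g u v\<bar> \<le> M * norm u * norm v) \<longrightarrow> (\<forall>u v. \<bar>h u v\<bar> \<le> M * norm u * norm v) \<longrightarrow>
    0 \<le> e \<longrightarrow> (\<forall>u v. \<bar>g u v - h u v\<bar> \<le> e * norm u * norm v) \<longrightarrow>
    \<bar>ricci br g v w - ricci br h v w\<bar> \<le> L * e * norm v * norm w"
proof -
  have bb: "bilinear br" using lie by (simp add: lie_bracket_def)
  obtain B where B: "B > 0" "\<And>u v. norm (br u v) \<le> B * norm u * norm v"
    using bilinear_bounded_pos[OF bb] by blast
  \<comment> \<open>\<open>P\<close> bounds the connections, \<open>Q * e\<close> their difference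
    and \<open>R * e\<close> that of the curvatures. In \<open>Q\<close>, the summand
    \<open>3 * B / 2\<close> comes from the Koszul terms and \<open>P\<close> from pairing the
    second connection with the change of metric.\<close>
  define P where "P = 3 * M * B / (2 * m)"
  define Q where "Q = (3 * B / 2 + P) / m"
  define R where "R = 4 * Q * P + Q * B"
  have Qm: "Q * m = 3 * B / 2 + P" using m by (simp add: Q_def)
  have PQR: "P \<ge> 0" "Q \<ge> 0" "R \<ge> 0"
    using m M B by (auto simp: P_def Q_def R_def)
  have cancel: "norm z \<le> k / m" if "m * (norm z)\<^sup>2 \<le> k * norm z" "k \<ge> 0" for k and z :: "real ^ 'n"
  proof (cases "z = 0")
    case False
    then show ?thesis using that m by (simp add: power2_eq_square field_simps)
  qed (use that m in simp)
  have koszul_le: "\<bar>(f (br u v) w - f (br v w) u + f (br w u) v) / 2\<bar>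
      \<le> 3 / 2 * k * B * norm u * norm v * norm w"
    if f: "\<And>u v. \<bar>f u v\<bar> \<le> k * norm u * norm v" and k: "k \<ge> 0"
    for f :: "real ^ 'n \<Rightarrow> real ^ 'n \<Rightarrow> real" and k u v w
  proof -
    have *: "\<bar>f (br u v) w\<bar> \<le> k * B * norm u * norm v * norm w" for u v w
    proof -
      have "\<bar>f (br u v) w\<bar> \<le> k * norm (br u v) * norm w" by (rule f)
      also have "\<dots> \<le> k * (B * norm u * norm v) * norm w"
        by (intro mult_right_mono mult_left_mono B k) auto
      finally show ?thesis by (simp add: mult_ac)
    qed
    show ?thesis using *[of u v w] *[of v w u] *[of w u v] by (simp add: mult_ac)
  qed
  have D_le: "norm (levi_civita br h u v) \<le> P * norm u * norm v"
    if h: "inner_product h" and low: "\<And>u. m * (norm u)\<^sup>2 \<le> h u u"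
      and up: "\<And>u v. \<bar>h u v\<bar> \<le> M * norm u * norm v" for h u v
  proof -
    note K = levi_civita_connection_koszul[OF h levi_civita_connection_levi_civita[OF h lie]]
    let ?z = "levi_civita br h u v"
    have "m * (norm ?z)\<^sup>2 \<le> h ?z ?z" by (rule low)
    also have "\<dots> \<le> 3 / 2 * M * B * norm u * norm v * norm ?z"
      unfolding K using koszul_le[of h M u v ?z, OF up M] by linarith
    finally have "norm ?z \<le> 3 / 2 * M * B * norm u * norm v / m"
      by (rule cancel) (use M B in simp)
    then show ?thesis by (simp add: P_def)
  qed
  have main: "\<bar>ricci br g v w - ricci br h v w\<bar> \<le> (real CARD('n) * R) * e * norm v * norm w"
    if g: "inner_product g" and h: "inner_product h"
      and glow: "\<And>u. m * (norm u)\<^sup>2 \<le> g u u" and hlow: "\<And>u. m * (norm u)\<^sup>2 \<le> h u u"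
      and gup: "\<And>u v. \<bar>g u v\<bar> \<le> M * norm u * norm v"
      and hup: "\<And>u v. \<bar>h u v\<bar> \<le> M * norm u * norm v"
      and e: "0 \<le> e" and gh: "\<And>u v. \<bar>g u v - h u v\<bar> \<le> e * norm u * norm v" for g h e v w
  proof -
    let ?D = "levi_civita br g" and ?E = "levi_civita br h"
    note cg = levi_civita_connection_levi_civita[OF g lie]
    note ch = levi_civita_connection_levi_civita[OF h lie]
    have bg: "bilinear g" using g by (simp add: inner_product_def)
    have bE: "bilinear ?E" and bD: "bilinear ?D"
      using cg ch by (auto simp: levi_civita_connection_def)
    have DP: "norm (?D u v) \<le> P * norm u * norm v" for u v by (rule D_le[OF g glow gup])
    have EP: "norm (?E u v) \<le> P * norm u * norm v" for u v by (rule D_le[OF h hlow hup])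
    have diff: "norm (?D u v - ?E u v) \<le> Q * e * norm u * norm v" for u v
    proof -
      let ?z = "?D u v - ?E u v"
      let ?f = "\<lambda>u v. g u v - h u v"
      \<comment> \<open>Pairing \<open>?E u v\<close> under \<open>g\<close> instead of
        \<open>h\<close> costs \<open>?f (?E u v) ?z\<close>. The other terms are the Koszul
        expression of \<open>?f\<close>, to which \<open>koszul_le\<close> applies with
        \<open>k = e\<close>.\<close>
      have "g ?z ?z = (?f (br u v) ?z - ?f (br v ?z) u + ?f (br ?z u) v) / 2 - ?f (?E u v) ?z"
        unfolding bilinear_lsub[OF bg]
        unfolding levi_civita_connection_koszul[OF g cg] levi_civita_connection_koszul[OF h ch]
        by (simp add: field_simps)
      also have "\<dots> \<le> 3 / 2 * e * B * norm u * norm v * norm ?z + e * norm (?E u v) * norm ?z"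
        using koszul_le[of ?f e u v ?z, OF gh e] gh[of "?E u v" ?z] by linarith
      also have "\<dots> \<le> 3 / 2 * e * B * norm u * norm v * norm ?z
          + e * (P * norm u * norm v) * norm ?z"
        by (intro add_left_mono mult_right_mono mult_left_mono EP e) auto
      also have "\<dots> = (Q * m) * e * norm u * norm v * norm ?z"
        unfolding Qm by (simp add: algebra_simps)
      finally have "m * (norm ?z)\<^sup>2 \<le> (Q * m * e * norm u * norm v) * norm ?z"
        using glow[of ?z] by linarith
      then have "norm ?z \<le> Q * m * e * norm u * norm v / m"
        by (rule cancel) (use m e PQR in simp)
      then show ?thesis using m by simp
    qed
    have two: "norm (?D a (?D b w) - ?E a (?E b w)) \<le> 2 * Q * P * e * norm a * norm b * norm w" for a b w
    proof -
      \<comment> \<open>The quadratic term is telescoped: first the outer connection changes, then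
        the inner one.\<close>
      have "?D a (?D b w) - ?E a (?E b w) = (?D a (?D b w) - ?E a (?D b w)) + ?E a (?D b w - ?E b w)"
        by (simp add: bilinear_rsub[OF bE])
      then have "norm (?D a (?D b w) - ?E a (?E b w)) \<le>
          norm (?D a (?D b w) - ?E a (?D b w)) + norm (?E a (?D b w - ?E b w))"
        by (metis norm_triangle_ineq)
      also have "\<dots> \<le> Q * e * norm a * norm (?D b w) + P * norm a * norm (?D b w - ?E b w)"
        by (intro add_mono diff EP)
      also have "\<dots> \<le> Q * e * norm a * (P * norm b * norm w) + P * norm a * (Q * e * norm b * norm w)"
        by (intro add_mono mult_left_mono diff DP mult_nonneg_nonneg PQR e norm_ge_zero)
      finally show ?thesis by (simp add: algebra_simps)
    qed
    have curv: "norm (curvature br g u v w - curvature br h u v w) \<le> R * e * norm u * norm v * norm w" for u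
    proof -
      have "norm (?D (br u v) w - ?E (br u v) w) \<le> Q * e * norm (br u v) * norm w" by (rule diff)
      also have "\<dots> \<le> Q * e * (B * norm u * norm v) * norm w"
        by (intro mult_right_mono mult_left_mono B mult_nonneg_nonneg PQR e norm_ge_zero)
      finally have br: "norm (?D (br u v) w - ?E (br u v) w) \<le> Q * e * (B * norm u * norm v) * norm w" .
      have "norm (curvature br g u v w - curvature br h u v w)
         = norm ((?D u (?D v w) - ?E u (?E v w)) - (?D v (?D u w) - ?E v (?E u w))
             - (?D (br u v) w - ?E (br u v) w))"
        by (simp add: curvature_def Let_def algebra_simps)
      also have "\<dots> \<le> norm (?D u (?D v w) - ?E u (?E v w)) + norm (?D v (?D u w) - ?E v (?E u w))
             + norm (?D (br u v) w - ?E (br u v) w)"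
        by (meson add_mono norm_triangle_ineq4 order_trans order_refl)
      also have "\<dots> \<le> 2 * Q * P * e * norm u * norm v * norm w + 2 * Q * P * e * norm v * norm u * norm w
          + Q * e * (B * norm u * norm v) * norm w"
        by (intro add_mono two br)
      finally show ?thesis by (simp add: R_def algebra_simps)
    qed
    have "ricci br g v w - ricci br h v w =
        (\<Sum>k\<in>UNIV. (curvature br g (axis k 1) v w - curvature br h (axis k 1) v w) $ k)"
      by (simp add: ricci_def trace_def matrix_def sum_subtractf)
    also have "\<bar>\<dots>\<bar> \<le> (\<Sum>k\<in>(UNIV::'n set). R * e * norm v * norm w)"
    proof (rule order_trans[OF sum_abs sum_mono])
      fix k :: 'n
      have "\<bar>(curvature br g (axis k 1) v w - curvature br h (axis k 1) v w) $ k\<bar>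
        \<le> norm (curvature br g (axis k 1) v w - curvature br h (axis k 1) v w)"
        by (rule component_le_norm_cart)
      also have "\<dots> \<le> R * e * norm v * norm w"
        using curv[of "axis k 1"] by simp
      finally show "\<bar>(curvature br g (axis k 1) v w - curvature br h (axis k 1) v w) $ k\<bar>
        \<le> R * e * norm v * norm w" .
    qed
    finally show ?thesis by (simp add: mult_ac)
  qed
  show ?thesis
    by (rule exI[of _ "real CARD('n) * R"]) (use PQR main in auto)
qed

section \<open>Uniform bounds for a compact family of metrics\<close>

lemma dual_frame_axis: "dual_frame UNIV (\<lambda>i::'n::finite. axis i 1) (\<lambda>i u. u $ i)"
proof -
  have "(\<Sum>i\<in>UNIV. u $ i *\<^sub>R axis i 1) = u" for u :: "real ^ 'n"
    using basis_expansion[of u] by (simp add: scalar_mult_eq_scaleR)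
  then show ?thesis by (auto simp: dual_frame_def axis_def intro!: linearI)
qed

text \<open>Supplies the constants for \<open>ricci_lipschitz\<close> along a compact time interval.
  \<open>M\<close> bounds the sum of the absolute matrix entries; \<open>m\<close> is a minimum over
  \<open>T\<close> times the unit sphere, extended to all vectors by homogeneity.\<close>

lemma inner_product_family_bounds:
  fixes h :: "real \<Rightarrow> real ^ 'n \<Rightarrow> real ^ 'n \<Rightarrow> real"
  assumes T: "compact T" and h: "\<And>t. t \<in> T \<Longrightarrow> inner_product (h t)"
    and cont: "\<And>u v. continuous_on T (\<lambda>t. h t u v)"
  shows "\<exists>m>0. \<exists>M\<ge>0. \<forall>t\<in>T. (\<forall>u. m * (norm u)\<^sup>2 \<le> h t u u) \<and>
    (\<forall>u v. \<bar>h t u v\<bar> \<le> M * norm u * norm v)"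
proof -
  let ?a = "\<lambda>t i j. h t (axis i 1) (axis j 1)"
  have bil: "bilinear (h t)" if "t \<in> T" for t
    using h[OF that] by (simp add: inner_product_def)
  have ex: "h t u v = (\<Sum>i\<in>UNIV. \<Sum>j\<in>UNIV. (u $ i * v $ j) * ?a t i j)" if "t \<in> T" for t u v
    using bilinear_expand_frame[OF dual_frame_axis bil[OF that], of u v] by simp
  have "bounded ((\<lambda>t. \<Sum>i\<in>UNIV. \<Sum>j\<in>UNIV. \<bar>?a t i j\<bar>) ` T)"
    by (intro compact_imp_bounded compact_continuous_image continuous_intros cont T)
  then obtain M where M0: "M > 0" and "\<forall>x\<in>(\<lambda>t. \<Sum>i\<in>UNIV. \<Sum>j\<in>UNIV. \<bar>?a t i j\<bar>) ` T. norm x \<le> M"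
    unfolding bounded_pos by blast
  then have M: "(\<Sum>i\<in>UNIV. \<Sum>j\<in>UNIV. \<bar>?a t i j\<bar>) \<le> M" if "t \<in> T" for t
  proof -
    from that \<open>\<forall>x\<in>_. _\<close> have "norm (\<Sum>i\<in>UNIV. \<Sum>j\<in>UNIV. \<bar>?a t i j\<bar>) \<le> M" by blast
    then show ?thesis by simp
  qed
  have up: "\<bar>h t u v\<bar> \<le> M * norm u * norm v" if t: "t \<in> T" for t u v
  proof -
    have "\<bar>h t u v\<bar> \<le> (\<Sum>i\<in>UNIV. \<Sum>j\<in>UNIV. \<bar>(u $ i * v $ j) * ?a t i j\<bar>)"
      unfolding ex[OF t, of u v] by (intro order_trans[OF sum_abs] sum_mono sum_abs)
    also have "\<dots> \<le> (\<Sum>i\<in>UNIV. \<Sum>j\<in>UNIV. (norm u * norm v) * \<bar>?a t i j\<bar>)"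
      unfolding abs_mult
      by (intro sum_mono mult_right_mono mult_mono component_le_norm_cart) auto
    also have "\<dots> = (norm u * norm v) * (\<Sum>i\<in>UNIV. \<Sum>j\<in>UNIV. \<bar>?a t i j\<bar>)"
      by (simp add: sum_distrib_left)
    also have "\<dots> \<le> (norm u * norm v) * M"
      by (intro mult_left_mono M t) auto
    finally show ?thesis by (simp add: mult_ac)
  qed
  have "\<exists>m>0. \<forall>t\<in>T. \<forall>u\<in>sphere 0 1. m \<le> h t u u"
  proof (cases "T = {}")
    case True
    then show ?thesis by (auto intro: exI[of _ 1])
  next
    case False
    let ?S = "T \<times> sphere (0 :: real ^ 'n) 1"
    \<comment> \<open>Continuity is assumed only in \<open>t\<close> for fixed vectors; in
      coordinates the quadratic form is visibly continuous in time and vector jointly.\<close>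
    let ?f = "\<lambda>p. \<Sum>i\<in>UNIV. \<Sum>j\<in>UNIV. (snd p $ i * snd p $ j) * ?a (fst p) i j"
    have S: "compact ?S" by (intro compact_Times T) simp
    have "axis undefined 1 \<in> sphere (0 :: real ^ 'n) 1" by simp
    with False have S': "?S \<noteq> {}" by blast
    have c: "continuous_on ?S (\<lambda>p. ?a (fst p) i j)" for i j
      by (rule continuous_on_compose2[OF cont[of "axis i 1" "axis j 1"]])
        (auto intro: continuous_on_fst continuous_on_id)
    have "continuous_on ?S ?f" by (intro continuous_intros c)
    from continuous_attains_inf[OF S S' this]
    obtain p where p: "p \<in> ?S" "\<And>q. q \<in> ?S \<Longrightarrow> ?f p \<le> ?f q" by blast
    have "?f p = h (fst p) (snd p) (snd p)" using p(1) ex[of "fst p" "snd p" "snd p"] by auto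
    moreover have "snd p \<noteq> 0" using p(1) by auto
    ultimately have "?f p > 0" using h[of "fst p"] p(1) by (auto simp: inner_product_def)
    moreover have "?f p \<le> h t u u" if "t \<in> T" "u \<in> sphere 0 1" for t u
      using p(2)[of "(t, u)"] that ex[of t u u] by simp
    ultimately show ?thesis by blast
  qed
  then obtain m where m: "m > 0" "\<And>t u. t \<in> T \<Longrightarrow> norm u = 1 \<Longrightarrow> m \<le> h t u u" by auto
  have "m * (norm u)\<^sup>2 \<le> h t u u" if t: "t \<in> T" for t u
  proof (cases "u = 0")
    case True
    then show ?thesis by (simp add: bilinear_lzero[OF bil[OF t]])
  next
    case False
    define w where "w = (1 / norm u) *\<^sub>R u"
    have u: "u = norm u *\<^sub>R w" and w: "norm w = 1" using False by (simp_all add: w_def)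
    have "h t u u = (norm u)\<^sup>2 * h t w w"
      by (subst u, subst (2) u)
        (simp add: bilinear_lmul[OF bil[OF t]] bilinear_rmul[OF bil[OF t]] power2_eq_square)
    then show ?thesis
      using mult_right_mono[OF m(2)[OF t w], of "(norm u)\<^sup>2"] by (simp add: mult_ac)
  qed
  with up m(1) M0 show ?thesis by (metis less_imp_le)
qed

section \<open>Gronwall's inequality and preservation of diagonality\<close>

text \<open>Multiplied by the integrating factor \<open>exp (- C * t)\<close>, the function
  \<open>f\<close> has nonpositive derivative.\<close>

lemma gronwall_nonpos:
  fixes f f' :: "real \<Rightarrow> real"
  assumes der: "\<And>t. 0 \<le> t \<Longrightarrow> t \<le> T \<Longrightarrow> (f has_real_derivative f' t) (at t)"
    and le: "\<And>t. 0 \<le> t \<Longrightarrow> t \<le> T \<Longrightarrow> f' t \<le> C * f t"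
    and 0: "f 0 \<le> 0" "0 \<le> T"
  shows "f T \<le> 0"
proof -
  have "f T * exp (- C * T) \<le> f 0 * exp (- C * 0)"
  proof (rule DERIV_nonpos_imp_nonincreasing[OF 0(2), where f = "\<lambda>t. f t * exp (- C * t)"])
    fix t assume t: "0 \<le> t" "t \<le> T"
    have "((\<lambda>t. f t * exp (- C * t)) has_real_derivative (f' t - C * f t) * exp (- C * t)) (at t)"
      by (auto intro!: derivative_eq_intros der t simp: algebra_simps)
    moreover have "(f' t - C * f t) * exp (- C * t) \<le> 0"
      using le[OF t] by (simp add: mult_le_0_iff)
    ultimately show "\<exists>y. ((\<lambda>t. f t * exp (- C * t)) has_real_derivative y) (at t) \<and> y \<le> 0" by blast
  qed
  with 0(1) have "f T * exp (- C * T) \<le> 0" by simp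
  then show ?thesis by (simp add: mult_le_0_iff)
qed

text \<open>Let \<open>E\<close> be the sum of the squared off-diagonal entries. The diagonal part
  \<open>d t\<close> has diagonal Ricci tensor by \<open>diag\<close> and differs from
  \<open>g t\<close> by a multiple of \<open>sqrt (E t)\<close>. The Lipschitz estimate bounds the
  off-diagonal Ricci entries of \<open>g t\<close> to the same order, so the derivative of
  \<open>E\<close> is at most \<open>C * E\<close> and Gronwall applies.\<close>

lemma ricci_flow_stays_diagonal:
  assumes lie: "lie_bracket br" and frame: "dual_frame S Y y" and flow: "ricci_flow br g0 I g"
    and diag: "\<And>h i j. inner_product h \<Longrightarrow>
      (\<And>k m. k \<in> S \<Longrightarrow> m \<in> S \<Longrightarrow> k \<noteq> m \<Longrightarrow> h (Y k) (Y m) = 0) \<Longrightarrow>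
      i \<in> S \<Longrightarrow> j \<in> S \<Longrightarrow> i \<noteq> j \<Longrightarrow> ricci br h (Y i) (Y j) = 0"
    and g0: "\<And>i j. i \<in> S \<Longrightarrow> j \<in> S \<Longrightarrow> i \<noteq> j \<Longrightarrow> g0 (Y i) (Y j) = 0"
    and T: "T \<in> I" "0 \<le> T" and ij: "i \<in> S" "j \<in> S" "i \<noteq> j"
  shows "g T (Y i) (Y j) = 0"
proof -
  define P where "P = {p \<in> S \<times> S. fst p \<noteq> snd p}"
  define a where "a t p = g t (Y (fst p)) (Y (snd p))" for t p
  define r where "r t p = ricci br (g t) (Y (fst p)) (Y (snd p))" for t p
  define E where "E t = (\<Sum>p\<in>P. (a t p)\<^sup>2)" for t
  define d where "d t = diagonal_part S Y y (g t)" for t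
  have fin: "finite S" and y: "\<And>i. i \<in> S \<Longrightarrow> linear (y i)"
    using frame by (auto simp: dual_frame_def)
  have finP: "finite P" using fin by (simp add: P_def)
  have sub: "{0..T} \<subseteq> I"
    using flow T by (auto simp: ricci_flow_def is_interval_1)
  have ip: "inner_product (g t)" if "t \<in> {0..T}" for t
    using flow that sub by (auto simp: ricci_flow_def)
  have der: "((\<lambda>s. g s u v) has_real_derivative - 2 * ricci br (g t) u v) (at t)" if "t \<in> {0..T}" for t u v
    using flow that sub by (auto simp: ricci_flow_def)
  have cont: "continuous_on {0..T} (\<lambda>t. g t u v)" for u v
    by (rule DERIV_continuous_on[OF DERIV_subset[OF der]]) auto
  have ipd: "inner_product (d t)" if "t \<in> {0..T}" for t
    unfolding d_def by (rule inner_product_diagonal_part[OF frame ip[OF that]])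
  have contd: "continuous_on {0..T} (\<lambda>t. d t u v)" for u v
    unfolding d_def diagonal_part_def by (intro continuous_intros cont)
  obtain m1 M1 where 1: "m1 > 0" "M1 \<ge> 0" "\<And>t u. t \<in> {0..T} \<Longrightarrow> m1 * (norm u)\<^sup>2 \<le> g t u u"
      "\<And>t u v. t \<in> {0..T} \<Longrightarrow> \<bar>g t u v\<bar> \<le> M1 * norm u * norm v"
    using inner_product_family_bounds[OF compact_Icc ip cont] by blast
  obtain m2 M2 where 2: "m2 > 0" "M2 \<ge> 0" "\<And>t u. t \<in> {0..T} \<Longrightarrow> m2 * (norm u)\<^sup>2 \<le> d t u u"
      "\<And>t u v. t \<in> {0..T} \<Longrightarrow> \<bar>d t u v\<bar> \<le> M2 * norm u * norm v"
    using inner_product_family_bounds[OF compact_Icc ipd contd] by blast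
  \<comment> \<open>\<open>ricci_lipschitz\<close> compares two metrics under common bounds, so one
    pair of constants serves both \<open>g t\<close> and \<open>d t\<close>.\<close>
  define m where "m = min m1 m2"
  define M where "M = max M1 M2"
  have m: "m > 0" and M: "M \<ge> 0" using 1 2 by (auto simp: m_def M_def)
  have low: "m * (norm u)\<^sup>2 \<le> g t u u" "m * (norm u)\<^sup>2 \<le> d t u u" if "t \<in> {0..T}" for t u
    using 1(3)[OF that, of u] 2(3)[OF that, of u]
      mult_right_mono[of m m1 "(norm u)\<^sup>2"] mult_right_mono[of m m2 "(norm u)\<^sup>2"]
    by (auto simp: m_def)
  have up: "\<bar>g t u v\<bar> \<le> M * norm u * norm v" "\<bar>d t u v\<bar> \<le> M * norm u * norm v"
    if "t \<in> {0..T}" for t u v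
    using 1(4)[OF that, of u v] 2(4)[OF that, of u v]
      mult_right_mono[of M1 M "norm u * norm v"] mult_right_mono[of M2 M "norm u * norm v"]
    by (auto simp: M_def mult.assoc)
  have "\<forall>i\<in>S. \<exists>N\<ge>0. \<forall>u. \<bar>y i u\<bar> \<le> N * norm u"
    using linear_bounded_pos[OF y] by (metis less_imp_le real_norm_def)
  then obtain N where N: "\<And>i. i \<in> S \<Longrightarrow> N i \<ge> 0" "\<And>i u. i \<in> S \<Longrightarrow> \<bar>y i u\<bar> \<le> N i * norm u"
    by metis
  define K where "K = (\<Sum>i\<in>S. \<Sum>j\<in>S. N i * N j)"
  have K: "K \<ge> 0" unfolding K_def by (intro sum_nonneg mult_nonneg_nonneg N)
  have E0: "E t \<ge> 0" for t by (simp add: E_def sum_nonneg)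
  have aE: "\<bar>a t p\<bar> \<le> sqrt (E t)" if "p \<in> P" for t p
    using member_le_sum[of p P "\<lambda>p. (a t p)\<^sup>2"] that finP
    by (auto simp: E_def intro!: real_le_rsqrt)
  \<comment> \<open>The two forms agree on the diagonal of the frame, and every other entry differs
    by at most \<open>sqrt (E t)\<close>; \<open>K\<close> absorbs the bounds of the coordinate
    functionals.\<close>
  have gd: "\<bar>g t u v - d t u v\<bar> \<le> (K * sqrt (E t)) * norm u * norm v" if t: "t \<in> {0..T}" for t u v
  proof -
    have b: "bilinear (g t)" "bilinear (d t)" using ip[OF t] ipd[OF t] by (auto simp: inner_product_def)
    have "\<bar>g t u v - d t u v\<bar> =
      \<bar>\<Sum>i\<in>S. \<Sum>j\<in>S. (y i u * y j v) * (g t (Y i) (Y j) - d t (Y i) (Y j))\<bar>"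
      unfolding bilinear_expand_frame[OF frame b(1), of u v] bilinear_expand_frame[OF frame b(2), of u v]
      by (simp add: sum_subtractf right_diff_distrib)
    also have "\<dots> \<le> (\<Sum>i\<in>S. \<Sum>j\<in>S. \<bar>(y i u * y j v) * (g t (Y i) (Y j) - d t (Y i) (Y j))\<bar>)"
      by (intro order_trans[OF sum_abs] sum_mono sum_abs)
    also have "\<dots> \<le> (\<Sum>i\<in>S. \<Sum>j\<in>S. ((N i * norm u) * (N j * norm v)) * sqrt (E t))"
      unfolding abs_mult
    proof (intro sum_mono mult_mono N)
      fix i j assume ij: "i \<in> S" "j \<in> S"
      show "\<bar>g t (Y i) (Y j) - d t (Y i) (Y j)\<bar> \<le> sqrt (E t)"
        using aE[of "(i, j)" t] ij E0[of t]
        by (cases "i = j") (auto simp: d_def diagonal_part_frame[OF frame] P_def a_def)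
    qed (auto intro!: mult_nonneg_nonneg N)
    also have "\<dots> = (K * sqrt (E t)) * norm u * norm v"
      by (simp add: K_def sum_distrib_left sum_distrib_right mult_ac)
    finally show ?thesis .
  qed
  obtain L where L: "L \<ge> 0" "\<And>g h e v w. inner_product g \<Longrightarrow> inner_product h \<Longrightarrow>
    (\<And>u. m * (norm u)\<^sup>2 \<le> g u u) \<Longrightarrow> (\<And>u. m * (norm u)\<^sup>2 \<le> h u u) \<Longrightarrow>
    (\<And>u v. \<bar>g u v\<bar> \<le> M * norm u * norm v) \<Longrightarrow> (\<And>u v. \<bar>h u v\<bar> \<le> M * norm u * norm v) \<Longrightarrow>
    0 \<le> e \<Longrightarrow> (\<And>u v. \<bar>g u v - h u v\<bar> \<le> e * norm u * norm v) \<Longrightarrow>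
    \<bar>ricci br g v w - ricci br h v w\<bar> \<le> L * e * norm v * norm w"
    using ricci_lipschitz[OF lie m M] by metis
  \<comment> \<open>Each summand of the derivative of \<open>E\<close> is \<open>-4\<close> times an
    entry times its Ricci entry, and both are of order \<open>sqrt (E t)\<close>.\<close>
  define C where "C = (\<Sum>p\<in>P. 4 * (L * K * norm (Y (fst p)) * norm (Y (snd p))))"
  have rE: "\<bar>r t p\<bar> \<le> L * (K * sqrt (E t)) * norm (Y (fst p)) * norm (Y (snd p))"
    if t: "t \<in> {0..T}" and p: "p \<in> P" for t p
  proof -
    have "ricci br (d t) (Y (fst p)) (Y (snd p)) = 0"
      using p by (intro diag ipd t) (auto simp: d_def diagonal_part_frame[OF frame] P_def)
    moreover have "\<bar>ricci br (g t) (Y (fst p)) (Y (snd p)) - ricci br (d t) (Y (fst p)) (Y (snd p))\<bar>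
      \<le> L * (K * sqrt (E t)) * norm (Y (fst p)) * norm (Y (snd p))"
      by (rule L(2)[OF ip[OF t] ipd[OF t] low[OF t] up[OF t] _ gd[OF t]]) (use K E0[of t] in simp)
    ultimately show ?thesis by (simp add: r_def)
  qed
  have "E T \<le> 0"
  proof (rule gronwall_nonpos[where f = E and T = T and C = C
        and f' = "\<lambda>t. \<Sum>p\<in>P. 2 * a t p * (- 2 * r t p)"])
    fix t assume "0 \<le> t" "t \<le> T"
    then have t: "t \<in> {0..T}" by simp
    show "(E has_real_derivative (\<Sum>p\<in>P. 2 * a t p * (- 2 * r t p))) (at t)"
      unfolding E_def[abs_def] a_def r_def
      by (rule DERIV_sum) (auto intro!: derivative_eq_intros der t)
    have "(\<Sum>p\<in>P. 2 * a t p * (- 2 * r t p)) \<le>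
        (\<Sum>p\<in>P. 4 * (L * K * norm (Y (fst p)) * norm (Y (snd p))) * E t)"
    proof (rule sum_mono)
      fix p assume p: "p \<in> P"
      have "2 * a t p * (- 2 * r t p) \<le> 4 * (\<bar>a t p\<bar> * \<bar>r t p\<bar>)"
        using abs_ge_minus_self[of "a t p * r t p"] by (simp add: abs_mult)
      also have "\<dots> \<le> 4 * (sqrt (E t) * (L * (K * sqrt (E t)) * norm (Y (fst p)) * norm (Y (snd p))))"
        by (intro mult_left_mono mult_mono aE p rE t) (use E0[of t] in auto)
      also have "\<dots> = 4 * (L * K * norm (Y (fst p)) * norm (Y (snd p))) * (sqrt (E t) * sqrt (E t))"
        by (simp only: mult_ac)
      finally show "2 * a t p * (- 2 * r t p) \<le> 4 * (L * K * norm (Y (fst p)) * norm (Y (snd p))) * E t"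
        using E0[of t] by simp
    qed
    then show "(\<Sum>p\<in>P. 2 * a t p * (- 2 * r t p)) \<le> C * E t"
      by (simp add: C_def sum_distrib_right)
  next
    show "E 0 \<le> 0"
      using flow g0 by (auto simp: E_def a_def P_def ricci_flow_def intro!: sum_nonpos)
  qed (use T in simp)
  with E0[of T] have "E T = 0" by simp
  then have "\<forall>p\<in>P. (a T p)\<^sup>2 = 0"
    using finP by (simp add: E_def sum_nonneg_eq_0_iff)
  moreover have "(i, j) \<in> P" using ij by (simp add: P_def)
  ultimately show ?thesis by (fastforce simp: a_def)
qed

section \<open>The initial Ricci tensor and coordinates in an orthogonal frame\<close>

text \<open>Vanishing is known only for nonnegative times, so the derivative at 0 is taken within
  \<open>{0..e}\<close>, where it is still unique.\<close>

lemma ricci_eq_0_if_flow_eq_0: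
  assumes flow: "ricci_flow br g0 I g"
    and 0: "\<And>t. t \<in> I \<Longrightarrow> t \<ge> 0 \<Longrightarrow> g t u v = 0"
  shows "ricci br g0 u v = 0"
proof -
  have I: "open I" "0 \<in> I" and g0: "g 0 = g0" using flow by (auto simp: ricci_flow_def)
  obtain e where e: "e > 0" "ball 0 e \<subseteq> I" using I by (meson open_contains_ball)
  have "((\<lambda>s. g s u v) has_real_derivative - 2 * ricci br g0 u v) (at 0)"
    using flow I g0 by (auto simp: ricci_flow_def)
  then have "((\<lambda>s. g s u v) has_real_derivative - 2 * ricci br g0 u v) (at 0 within {0..e})"
    by (rule DERIV_subset) simp
  moreover have "((\<lambda>s. g s u v) has_real_derivative 0) (at 0 within {0..e})"
    by (rule has_field_derivative_transform_within[OF DERIV_const[of 0], of e])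
      (use e 0 in \<open>auto simp: subset_iff dist_real_def\<close>)
  moreover have "at 0 within {0..e} \<noteq> bot"
    using e(1) at_within_Icc_at_right[of 0 e] by (simp add: trivial_limit_at_right_real)
  ultimately show ?thesis using has_field_derivative_unique by fastforce
qed

text \<open>The functionals are Fourier coefficients. The resulting expansion is linear in
  \<open>u\<close> and fixes each \<open>Y j\<close>, hence is the identity on their span.\<close>

lemma dual_frame_orthogonal:
  assumes g: "inner_product g" and fin: "finite S" and span: "span (Y ` S) = UNIV"
    and orth: "\<And>i j. i \<in> S \<Longrightarrow> j \<in> S \<Longrightarrow> i \<noteq> j \<Longrightarrow> g (Y i) (Y j) = 0"
    and pos: "\<And>i. i \<in> S \<Longrightarrow> g (Y i) (Y i) > 0"
  shows "dual_frame S Y (\<lambda>i u. g u (Y i) / g (Y i) (Y i))"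
proof -
  let ?y = "\<lambda>i u. g u (Y i) / g (Y i) (Y i)"
  have bg: "bilinear g" using g by (simp add: inner_product_def)
  have y: "linear (?y i)" for i
    by (rule linearI) (simp_all add: bilinear_ladd[OF bg] bilinear_lmul[OF bg] add_divide_distrib)
  have dual: "?y i (Y j) = (if i = j then 1 else 0)" if "i \<in> S" "j \<in> S" for i j
    using orth[of j i] pos[of i] that by auto
  have lin: "linear (\<lambda>u. \<Sum>i\<in>S. ?y i u *\<^sub>R Y i)"
    by (rule linearI)
      (simp_all only: linear_add[OF y] linear_cmul[OF y] scaleR_left_distrib sum.distrib
        scaleR_sum_right scaleR_scaleR real_scaleR_def)
  have "(\<Sum>i\<in>S. ?y i u *\<^sub>R Y i) = u" for u
  proof -
    have "(\<Sum>i\<in>S. ?y i u *\<^sub>R Y i) = id u"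
    proof (rule linear_eq_on_span[OF lin linear_id, of "Y ` S"])
      fix x assume "x \<in> Y ` S"
      then obtain j where j: "j \<in> S" "x = Y j" by blast
      have "(\<Sum>i\<in>S. ?y i x *\<^sub>R Y i) = (\<Sum>i\<in>S. if i = j then Y j else 0)"
        using j dual by (intro sum.cong) auto
      then show "(\<Sum>i\<in>S. ?y i x *\<^sub>R Y i) = id x" using j fin by simp
    qed (simp add: span)
    then show ?thesis by simp
  qed
  with fin y dual show ?thesis by (simp add: dual_frame_def)
qed

lemma frame_ricci_cong:
  assumes "\<And>i j k. i \<in> S \<Longrightarrow> j \<in> S \<Longrightarrow> k \<in> S \<Longrightarrow> c i j k = c' i j k"
    and "i \<in> S" "j \<in> S"
  shows "frame_ricci S c l i j = frame_ricci S c' l i j"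
  unfolding frame_ricci_def frame_connection_def
  using assms by (intro sum.cong) auto

section \<open>Ricci entries for the three-parameter family of structure constants\<close>

text \<open>The structure constants of the frame \<open>Y\<close> in terms of the parameters \<open>b\<close>, \<open>p\<close>, \<open>q\<close> above.\<close>

definition family_constant :: "real \<Rightarrow> real \<Rightarrow> real \<Rightarrow> nat \<Rightarrow> nat \<Rightarrow> nat \<Rightarrow> real" where
  "family_constant b p q i j k =
     (if i = 2 \<and> j = 3 then (if k = 4 then -1 else 0)
      else if i = 3 \<and> j = 2 then (if k = 4 then 1 else 0)
      else if i = 3 \<and> j = 1 then (if k = 2 then 1 else if k = 3 then -b else if k = 4 then p else 0)
      else if i = 1 \<and> j = 3 then (if k = 2 then -1 else if k = 3 then b else if k = 4 then -p else 0)
      else if i = 1 \<and> j = 2 then (if k = 2 then -b else if k = 3 then 1 + b\<^sup>2 else if k = 4 then q else 0)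
      else if i = 2 \<and> j = 1 then (if k = 2 then b else if k = 3 then -1 - b\<^sup>2 else if k = 4 then -q else 0)
      else 0)"

lemma atLeastAtMost_1_4: "{1..4} = {1, 2, 3, 4::nat}"
  by auto

context
  fixes l :: "nat \<Rightarrow> real"
  assumes l: "\<And>i. i \<in> {1..4} \<Longrightarrow> l i > 0"
begin

text \<open>The first index appears as \<open>Suc 0\<close>, the form to which the simplifier
  rewrites it.\<close>

lemma l_pos: "l (Suc 0) > 0" "l 2 > 0" "l 3 > 0" "l 4 > 0"
  using l by auto

text \<open>Together with \<open>frame_ricci_family_34\<close> this is, up to positive factors, the
  matrix with rows (1, -b) and (-b, 1 + b^2) applied to (p * l 2, q * l 3). Its determinant is 1, so
  both entries vanish only for p = q = 0.\<close>

lemma frame_ricci_family_24: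
  "frame_ricci {1..4} (family_constant b p q) l 2 4 = l 4 / (2 * l 1 * l 3) * (p * l 2 - b * q * l 3)"
  using l_pos unfolding frame_ricci_def atLeastAtMost_1_4 frame_connection_def
  by (simp add: family_constant_def, simp add: field_simps power2_eq_square)

lemma frame_ricci_family_34:
  "frame_ricci {1..4} (family_constant b p q) l 3 4 = l 4 / (2 * l 1 * l 2) * ((1 + b\<^sup>2) * q * l 3 - b * p * l 2)"
  using l_pos unfolding frame_ricci_def atLeastAtMost_1_4 frame_connection_def
  by (simp add: family_constant_def, simp add: field_simps power2_eq_square)

text \<open>Applied once the entries (2,4) and (3,4) have forced p = q = 0. The last factor is
  positive, so this entry detects \<open>b\<close>.\<close>

lemma frame_ricci_family_23:
  "frame_ricci {1..4} (family_constant b 0 0) l 2 3 = - b / l 1 * (l 2 + (1 + b\<^sup>2) * l 3)"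
  using l_pos unfolding frame_ricci_def atLeastAtMost_1_4 frame_connection_def
  by (simp add: family_constant_def, simp add: field_simps power2_eq_square)

text \<open>Each bracket is now a multiple of a single frame vector; the finitely many off-diagonal
  entries are evaluated case by case.\<close>

lemma frame_ricci_family_diagonal:
  assumes "i \<in> {1..4}" "j \<in> {1..4}" "i \<noteq> j"
  shows "frame_ricci {1..4} (family_constant 0 0 0) l i j = 0"
proof -
  have "frame_ricci {1..4} (family_constant 0 0 0) l i j = 0"
    if "i = i'" "j = j'" "i' \<in> {1, 2, 3, 4}" "j' \<in> {1, 2, 3, 4}" "i' \<noteq> j'" for i' j'
    using that(3-5) l_pos
    unfolding that(1,2) frame_ricci_def atLeastAtMost_1_4 frame_connection_def
    by (elim insertE; simp add: family_constant_def; simp add: field_simps)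
  with assms show ?thesis unfolding atLeastAtMost_1_4 by blast
qed

end

section \<open>Application to the four-dimensional Lie algebra\<close>

theorem proposition7:
  fixes br :: "real ^ 4 \<Rightarrow> real ^ 4 \<Rightarrow> real ^ 4"
    and X Y :: "nat \<Rightarrow> real ^ 4"
    and a lam :: "nat \<Rightarrow> real"
    and g0 :: "real ^ 4 \<Rightarrow> real ^ 4 \<Rightarrow> real"
    and I :: "real set"
    and g :: "real \<Rightarrow> real ^ 4 \<Rightarrow> real ^ 4 \<Rightarrow> real"
  assumes lie: "lie_bracket br"
    and basis: "inj_on X {1..4}" "independent (X ` {1..4})" "span (X ` {1..4}) = UNIV"
    and central: "br (X 1) (X 4) = 0" "br (X 2) (X 4) = 0" "br (X 3) (X 4) = 0"
    and brackets: "br (X 2) (X 3) = - X 4" "br (X 3) (X 1) = X 2" "br (X 1) (X 2) = X 3"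
    and Y: "Y 1 = X 1 + a 4 *\<^sub>R X 2 + a 5 *\<^sub>R X 3 + a 6 *\<^sub>R X 4"
      "Y 2 = X 2 + a 2 *\<^sub>R X 3 + a 3 *\<^sub>R X 4"
      "Y 3 = X 3 + a 1 *\<^sub>R X 4"
      "Y 4 = X 4"
    and lam_pos: "\<forall>i\<in>{1..4}. lam i > 0"
    and g0: "inner_product g0"
      "\<forall>i\<in>{1..4}. \<forall>j\<in>{1..4}. g0 (Y i) (Y j) = (if i = j then lam i else 0)"
    and flow: "maximal_ricci_flow br g0 I g"
  shows "(\<forall>t\<in>I. t \<ge> 0 \<longrightarrow> (\<forall>i\<in>{1..4}. \<forall>j\<in>{1..4}. i \<noteq> j \<longrightarrow> g t (Y i) (Y j) = 0)) \<longleftrightarrow>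
         a 2 = 0 \<and> a 1 = a 5 \<and> a 3 = a 4"
proof -
  note One_nat_def [simp del]
  let ?S = "{1..4::nat}"
  \<comment> \<open>Although written with \<open>g0\<close>, these are the coordinates of the basis
    \<open>Y\<close>, so the same \<open>y\<close> serves every metric \<open>h\<close>
    below.\<close>
  define y where "y i u = g0 u (Y i) / g0 (Y i) (Y i)" for i u
  define b where "b = a 2"
  \<comment> \<open>Substituting X3 = Y3 - a1 Y4 and X2 = Y2 - a2 Y3 + (a2 a1 - a3) Y4 in the
    brackets leaves \<open>p\<close> and \<open>q\<close> as the coefficients of \<open>Y 4\<close>
    in [Y3, Y1] and [Y1, Y2].\<close>
  define p where "p = a 2 * a 1 - a 3 + a 4"
  define q where "q = a 5 - a 1 - (a 2)\<^sup>2 * a 1 + a 2 * a 3 - a 4 * a 2"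
  have rf: "ricci_flow br g0 I g" using flow by (simp add: maximal_ricci_flow_def)
  have bb: "bilinear br" and alt: "br u u = 0" for u
    using lie by (auto simp: lie_bracket_def)
  note bs = bilinear_ladd[OF bb] bilinear_radd[OF bb] bilinear_lmul[OF bb] bilinear_rmul[OF bb]
  have skew: "br u v = - br v u" for u v
    using alt[of "u + v"] alt[of u] alt[of v] by (simp add: bs eq_neg_iff_add_eq_0 add.commute)
  have X_skew: "br (X 4) (X 1) = 0" "br (X 4) (X 2) = 0" "br (X 4) (X 3) = 0"
    "br (X 3) (X 2) = X 4" "br (X 1) (X 3) = - X 2" "br (X 2) (X 1) = - X 3"
    using central brackets skew[of "X 4"] skew[of "X 3" "X 2"] skew[of "X 1" "X 3"] skew[of "X 2" "X 1"]
    by simp_all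
  have Y_br: "br (Y 2) (Y 3) = - Y 4"
    "br (Y 3) (Y 1) = Y 2 - b *\<^sub>R Y 3 + p *\<^sub>R Y 4"
    "br (Y 1) (Y 2) = - b *\<^sub>R Y 2 + (1 + b\<^sup>2) *\<^sub>R Y 3 + q *\<^sub>R Y 4"
    "br (Y 1) (Y 4) = 0" "br (Y 2) (Y 4) = 0" "br (Y 3) (Y 4) = 0"
    unfolding Y b_def p_def q_def
    by (simp_all add: bs X_skew central brackets alt algebra_simps power2_eq_square)
  have Y_skew: "br (Y 3) (Y 2) = Y 4"
    "br (Y 1) (Y 3) = - Y 2 + b *\<^sub>R Y 3 - p *\<^sub>R Y 4"
    "br (Y 2) (Y 1) = b *\<^sub>R Y 2 - (1 + b\<^sup>2) *\<^sub>R Y 3 - q *\<^sub>R Y 4"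
    "br (Y 4) (Y 1) = 0" "br (Y 4) (Y 2) = 0" "br (Y 4) (Y 3) = 0"
    using Y_br skew[of "Y 4"] skew[of "Y 3" "Y 2"] skew[of "Y 1" "Y 3"] skew[of "Y 2" "Y 1"]
    by simp_all
  \<comment> \<open>\<open>Y\<close> is unitriangular over \<open>X\<close>, so \<open>X 4\<close>,
    \<open>X 3\<close>, \<open>X 2\<close>, \<open>X 1\<close> are recovered in this order.\<close>
  have "X i \<in> span (Y ` ?S)" if "i \<in> ?S" for i
  proof -
    have Ys: "Y j \<in> span (Y ` ?S)" if "j \<in> ?S" for j
      using that by (intro span_base) auto
    have X4: "X 4 \<in> span (Y ` ?S)" using Ys[of 4] by (simp add: Y)
    have "Y 3 - a 1 *\<^sub>R X 4 \<in> span (Y ` ?S)"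
      by (intro span_diff span_scale Ys X4) simp
    then have X3: "X 3 \<in> span (Y ` ?S)" by (simp add: Y)
    have "Y 2 - a 2 *\<^sub>R X 3 - a 3 *\<^sub>R X 4 \<in> span (Y ` ?S)"
      by (intro span_diff span_scale Ys X3 X4) simp
    then have X2: "X 2 \<in> span (Y ` ?S)" by (simp add: Y)
    have "Y 1 - a 4 *\<^sub>R X 2 - a 5 *\<^sub>R X 3 - a 6 *\<^sub>R X 4 \<in> span (Y ` ?S)"
      by (intro span_diff span_scale Ys X2 X3 X4) simp
    then have "X 1 \<in> span (Y ` ?S)" unfolding Y by simp
    with X2 X3 X4 that show ?thesis unfolding atLeastAtMost_1_4 by blast
  qed
  then have "span (X ` ?S) \<subseteq> span (Y ` ?S)"
    by (intro span_minimal) auto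
  then have "span (Y ` ?S) = UNIV" using basis(3) by blast
  then have frame: "dual_frame ?S Y y"
    unfolding y_def using g0 lam_pos by (intro dual_frame_orthogonal) auto
  have y: "linear (y i)" if "i \<in> ?S" for i
    using frame that unfolding dual_frame_def by blast
  have dual: "y i (Y j) = (if i = j then 1 else 0)" if "i \<in> ?S" "j \<in> ?S" for i j
    using frame that unfolding dual_frame_def by blast
  have const: "y k (br (Y i) (Y j)) = family_constant b p q i j k"
    if "i \<in> ?S" "j \<in> ?S" "k \<in> ?S" for i j k
  proof -
    have "i \<in> {1, 2, 3, 4}" "j \<in> {1, 2, 3, 4}" using that(1,2) unfolding atLeastAtMost_1_4 .
    then show ?thesis
      using that(3)
      by (elim insertE emptyE;
          simp only: Y_br Y_skew alt linear_add[OF y] linear_diff[OF y] linear_neg[OF y]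
            linear_cmul[OF y] linear_0[OF y];
          auto simp: dual family_constant_def)
  qed
  \<comment> \<open>The structure constants do not involve the metric; among metrics diagonal in
    \<open>Y\<close> only the lengths vary.\<close>
  have ric: "ricci br h (Y i) (Y j) = frame_ricci ?S (family_constant b p q) (\<lambda>i. h (Y i) (Y i)) i j"
    if "inner_product h" "\<And>i j. i \<in> ?S \<Longrightarrow> j \<in> ?S \<Longrightarrow> i \<noteq> j \<Longrightarrow> h (Y i) (Y j) = 0" "i \<in> ?S" "j \<in> ?S" for h i j
    using ricci_orthogonal_frame[OF frame that(1) lie that(2-4)]
      frame_ricci_cong[of ?S "\<lambda>i j k. y k (br (Y i) (Y j))" "family_constant b p q", OF const that(3,4)]
    by simp
  have Y_pos: "h (Y i) (Y i) > 0" if "inner_product h" "i \<in> ?S" for h i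
  proof -
    have "Y i \<noteq> 0" using g0(1,2) lam_pos that(2) dual[of i i] linear_0[OF y[of i]] by fastforce
    then show ?thesis using that(1) by (simp add: inner_product_def)
  qed
  \<comment> \<open>At b = 0, \<open>p\<close> becomes \<open>a 4 - a 3\<close> and \<open>q\<close>
    becomes \<open>a 5 - a 1\<close>.\<close>
  have bpq: "b = 0 \<and> p = 0 \<and> q = 0 \<longleftrightarrow> a 2 = 0 \<and> a 1 = a 5 \<and> a 3 = a 4"
    by (auto simp: b_def p_def q_def)
  show ?thesis
  proof
    assume diag: "\<forall>t\<in>I. t \<ge> 0 \<longrightarrow> (\<forall>i\<in>?S. \<forall>j\<in>?S. i \<noteq> j \<longrightarrow> g t (Y i) (Y j) = 0)"
    have z: "frame_ricci ?S (family_constant b p q) (\<lambda>i. g0 (Y i) (Y i)) i j = 0"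
      if "i \<in> ?S" "j \<in> ?S" "i \<noteq> j" for i j
      using ric[OF g0(1) _ that(1,2)] ricci_eq_0_if_flow_eq_0[OF rf, of "Y i" "Y j"] g0(2) diag that
      by simp
    define l where "l i = g0 (Y i) (Y i)" for i
    have l: "l i > 0" if "i \<in> ?S" for i using Y_pos[OF g0(1) that] by (simp add: l_def)
    have lp: "l 1 > 0" "l 2 > 0" "l 3 > 0" "l 4 > 0" by (simp_all add: l)
    note z = z[folded l_def[abs_def]]
    have e1: "p * l 2 = b * q * l 3"
      using z[of 2 4] frame_ricci_family_24[where l = l and b = b and p = p and q = q, OF l] lp by simp
    have e2: "(1 + b\<^sup>2) * q * l 3 = b * p * l 2"
      using z[of 3 4] frame_ricci_family_34[where l = l and b = b and p = p and q = q, OF l] lp by simp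
    \<comment> \<open>Inserting \<open>e1\<close> into \<open>e2\<close> leaves b^2 q l3 on both
      sides; the surviving coefficient 1 is the determinant of the system.\<close>
    have "(1 + b\<^sup>2) * q * l 3 = b * (b * q * l 3)"
      using e2 e1 by (simp add: mult.assoc)
    then have "q * l 3 = 0" by (simp add: algebra_simps power2_eq_square)
    with lp have q: "q = 0" by simp
    with e1 lp have p: "p = 0" by simp
    have "1 + b\<^sup>2 > 0" by (simp add: add_pos_nonneg)
    then have "l 2 + (1 + b\<^sup>2) * l 3 > 0" using lp by (simp add: add_pos_pos)
    then have "b = 0"
      using z[of 2 3] frame_ricci_family_23[where l = l and b = b, OF l] lp p q by simp
    with p q bpq show "a 2 = 0 \<and> a 1 = a 5 \<and> a 3 = a 4" by simp
  next
    assume "a 2 = 0 \<and> a 1 = a 5 \<and> a 3 = a 4"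
    then have 0: "b = 0" "p = 0" "q = 0" using bpq by simp_all
    have "g t (Y i) (Y j) = 0" if "t \<in> I" "t \<ge> 0" "i \<in> ?S" "j \<in> ?S" "i \<noteq> j" for t i j
    \<comment> \<open>The condition is verified for every metric diagonal in \<open>Y\<close>, since
      the comparison metric \<open>diagonal_part\<close> of \<open>g t\<close> is not known to lie
      on the flow.\<close>
    proof (rule ricci_flow_stays_diagonal[OF lie frame rf _ _ that])
      fix h i j
      assume h: "inner_product h" "\<And>k m. k \<in> ?S \<Longrightarrow> m \<in> ?S \<Longrightarrow> k \<noteq> m \<Longrightarrow> h (Y k) (Y m) = 0"
        and ij: "i \<in> ?S" "j \<in> ?S" "i \<noteq> j"
      show "ricci br h (Y i) (Y j) = 0"
        using ric[OF h ij(1,2)] frame_ricci_family_diagonal[where l = "\<lambda>i. h (Y i) (Y i)", OF Y_pos[OF h(1)] ij] unfolding 0 by simp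
    qed (use g0(2) in simp)
    then show "\<forall>t\<in>I. t \<ge> 0 \<longrightarrow> (\<forall>i\<in>?S. \<forall>j\<in>?S. i \<noteq> j \<longrightarrow> g t (Y i) (Y j) = 0)" by blast
  qed
qed

end
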